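(* Let $\Omega=\prod_{k=1}^n\Omega_k$ with product probability measure $\mu=\bigotimes_{k=1}^n\mu_k$, and let $f$ be a bounded measurable real function on $\Omega$. Suppose that there are non-negative numbers $a,b$ such that $Df\le af+b$. Then for every $t>0$ $$\Pr\{f-E[f]>t\}\le\exp\left(\frac{-t^2}{2(aE[f]+b+at/2)}\right).$$ If, in addition, $a\ge1$ and $f-\inf_kf\le1$ for all $k\in\{1,\ldots,n\}$, then for every $t>0$ $$\Pr\{E[f]-f>t\}\le\exp\left(\frac{-t^2}{2(aE[f]+b)}\right).$$
   Context: $E[g]=\int_\Omega g\,\mathrm{d}\mu$ and $\Pr$ is probability under $\mu$. For $\mathbf{x}\in\Omega$ and $y\in\Omega_k$, $\mathbf{x}_{y,k}$ denotes $\mathbf{x}$ with its $k$th coordinate replaced by $y$, and $(\inf_kg)(\mathbf{x})=\inf_{y\in\Omega_k}g(\mathbf{x}_{y,k})$. The worst-case variance proxy of $g$ is the function $Dg=\sum_{k=1}^n(g-\inf_kg)^2$. Inequalities between functions are pointwise on $\Omega$. Measurability questions are ignored: the functions $\inf_kf$ are assumed measurable. If a denominator is $0$ the corresponding right-hand side is read as $0$. *)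

theory Defs
  imports "HOL-Probability.Probability"
begin

text \<open>
  A point of the product space is a function on the index set (extended by \<^const>\<open>undefined\<close>),
  so replacing its \<open>k\<close>-th coordinate by \<open>y\<close> is the function update \<open>x(k := y)\<close>.
  The infimum is a real (conditionally complete) one; it is meaningful for \<open>g\<close> bounded below.
\<close>

definition inf_coord :: "(nat \<Rightarrow> 'a measure) \<Rightarrow> nat \<Rightarrow> ((nat \<Rightarrow> 'a) \<Rightarrow> real) \<Rightarrow> (nat \<Rightarrow> 'a) \<Rightarrow> real"
  where "inf_coord M k g x = (INF y\<in>space (M k). g (x(k := y)))"

definition variance_proxy ::
    "nat \<Rightarrow> (nat \<Rightarrow> 'a measure) \<Rightarrow> ((nat \<Rightarrow> 'a) \<Rightarrow> real) \<Rightarrow> (nat \<Rightarrow> 'a) \<Rightarrow> real"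
  where "variance_proxy n M g x = (\<Sum>k=1..n. (g x - inf_coord M k g x)\<^sup>2)"

text \<open>
  The Gaussian-type bound with denominator \<open>2 * d\<close>, read as \<open>0\<close> when the denominator vanishes
  (HOL's \<open>x / 0 = 0\<close> would give the value \<open>1\<close> instead).
\<close>

definition tail_bound :: "real \<Rightarrow> real \<Rightarrow> real"
  where "tail_bound t d = (if 2 * d = 0 then 0 else exp (- t\<^sup>2 / (2 * d)))"

end

theory Submission imports Defs begin

text \<open>
  The entropy method. Write \<open>X = f - E f\<close>, \<open>V = a * E f + b\<close>, \<open>L s = ln (E (exp (s * X)))\<close>.
  Subadditivity of entropy, with \<open>exp (s * inf_k f)\<close> as the competitor in the variational formula for
  the entropy in coordinate \<open>k\<close>, bounds the entropy of \<open>exp (s * X)\<close> by \<open>K s * E (Df * exp (s * X))\<close>, where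
  \<open>K s = s\<^sup>2 / 2\<close> if \<open>s > 0\<close>, and \<open>K s = exp (- s) + s - 1\<close> if \<open>s < 0\<close> and \<open>f - inf_k f \<le> 1\<close>.
  Since \<open>Df \<le> a * X + V\<close>, this is the differential inequality \<open>s * L' s - L s \<le> K s * (a * L' s + V)\<close>.
  Integrating it from \<open>0\<close> bounds \<open>L\<close>, and the Chernoff bound with optimal \<open>s\<close> gives both tails.
\<close>

subsection \<open>Differential inequalities for the logarithmic moment generating function\<close>

text \<open>The product \<open>(1 - u + u^2/2) * (1 + u + u^2/2)\<close> equals
  \<open>1 + u^4/4\<close>, and \<open>exp u\<close> dominates the second factor for
  \<open>u \<ge> 0\<close>. Dividing by \<open>exp u\<close> gives the claim.\<close>

lemma exp_minus_le_quadratic: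
  fixes u :: real
  assumes "0 \<le> u"
  shows "exp (- u) + u - 1 \<le> u\<^sup>2 / 2"
proof -
  have "1 \<le> (1 - u + u\<^sup>2 / 2) * (1 + u + u\<^sup>2 / 2)"
    using assms by (simp add: field_simps power2_eq_square)
  also have "\<dots> \<le> (1 - u + u\<^sup>2 / 2) * exp u"
  proof (rule mult_left_mono)
    show "1 + u + u\<^sup>2 / 2 \<le> exp u"
      using exp_lower_Taylor_quadratic[OF assms] by simp
    have "0 \<le> (1 - u)\<^sup>2 + 1" by simp
    then show "0 \<le> 1 - u + u\<^sup>2 / 2" by (simp add: power2_eq_square algebra_simps)
  qed
  finally have "inverse (exp u) \<le> 1 - u + u\<^sup>2 / 2"
    by (simp add: inverse_eq_divide pos_divide_le_eq)
  then show ?thesis by (simp add: exp_minus)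
qed

text \<open>Termwise comparison of the exponential series from the quadratic term on: each
  \<open>u ^ (n + 2)\<close> is at most \<open>u^2\<close> because \<open>u\<close> lies in the unit
  interval. This is where the assumption \<open>f - inf_k f \<le> 1\<close> becomes
  effective.\<close>

lemma exp_remainder_scale:
  fixes s u :: real
  assumes "0 \<le> s" "0 \<le> u" "u \<le> 1"
  shows "exp (s * u) - s * u - 1 \<le> u\<^sup>2 * (exp s - s - 1)"
proof -
  let ?r = "\<lambda>x n. inverse (fact (n + 2)) *\<^sub>R x ^ (n + 2) :: real"
  have sm: "summable (?r x)" for x
    using summable_exp_generic[of x] by (subst summable_iff_shift) simp
  have "(\<Sum>n. ?r (s * u) n) \<le> (\<Sum>n. u\<^sup>2 * ?r s n)"
  proof (intro suminf_le sm summable_mult allI)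
    fix n
    have "u ^ (n + 2) \<le> u\<^sup>2" using assms by (intro power_decreasing) auto
    then have "(inverse (fact (n + 2)) * s ^ (n + 2)) * u ^ (n + 2) \<le> (inverse (fact (n + 2)) * s ^ (n + 2)) * u\<^sup>2"
      using assms by (intro mult_left_mono mult_nonneg_nonneg) auto
    then show "?r (s * u) n \<le> u\<^sup>2 * ?r s n"
      by (simp only: power_mult_distrib real_scaleR_def mult_ac)
  qed
  also have "\<dots> = u\<^sup>2 * (\<Sum>n. ?r s n)" by (rule suminf_mult[OF sm])
  finally show ?thesis
    using exp_first_two_terms[of "s * u"] exp_first_two_terms[of s] by simp
qed

text \<open>Serves to integrate from 0 when the function is a quotient that is singular at 0 and has
  only a one-sided limit there.\<close>

lemma le_right_limit_of_deriv_nonpos: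
  fixes p :: "real \<Rightarrow> real"
  assumes d: "\<And>s. 0 < s \<Longrightarrow> (p has_real_derivative p' s) (at s)"
    and n: "\<And>s. 0 < s \<Longrightarrow> p' s \<le> 0"
    and l: "(p \<longlongrightarrow> l) (at_right 0)" and "0 < s"
  shows "p s \<le> l"
proof (rule tendsto_lowerbound[OF l])
  show "\<forall>\<^sub>F x in at_right 0. p s \<le> p x"
    using eventually_at_right_less[of 0] eventually_at_right_real[OF \<open>0 < s\<close>]
  proof eventually_elim
    case (elim x)
    show ?case
    proof (rule DERIV_nonpos_imp_nonincreasing[where f = p and a = x and b = s])
      show "x \<le> s" using elim by simp
      fix r assume "x \<le> r"
      then have "0 < r" using elim by simp
      then show "\<exists>y. (p has_real_derivative y) (at r) \<and> y \<le> 0"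
        using d n by blast
    qed
  qed
qed simp

lemma tendsto_quotient_deriv_0:
  fixes L :: "real \<Rightarrow> real"
  assumes "(L has_real_derivative D) (at 0)" "L 0 = 0"
  shows "((\<lambda>s. L s / s) \<longlongrightarrow> D) (at_right 0)"
proof (rule filterlim_mono[OF _ order_refl at_le])
  show "((\<lambda>s. L s / s) \<longlongrightarrow> D) (at 0)"
    using assms by (simp add: DERIV_def)
qed simp

text \<open>Division by \<open>s^2\<close> makes both sides exact derivatives: the left side becomes
  \<open>(L s / s)'\<close> and the right side \<open>(a * L s + V * s)' / 2\<close>. Their
  difference \<open>p\<close> therefore decreases from its limit 0 at the origin. Leaving
  \<open>1 - a * s / 2\<close> as a factor avoids any condition on its sign.\<close>

lemma upper_log_mgf_bound:
  fixes L L' :: "real \<Rightarrow> real"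
  assumes d: "\<And>s. (L has_real_derivative L' s) (at s)"
    and "L 0 = 0" "L' 0 = 0"
    and ineq: "\<And>s. 0 < s \<Longrightarrow> s * L' s - L s \<le> s\<^sup>2 / 2 * (a * L' s + V)"
    and "0 < s"
  shows "L s * (1 - a * s / 2) \<le> V * s\<^sup>2 / 2"
proof -
  define p where "p = (\<lambda>s. L s / s - (a * L s + V * s) / 2)"
  define p' where "p' = (\<lambda>s. (L' s * s - L s) / s\<^sup>2 - (a * L' s + V) / 2)"
  have "p s \<le> 0 - (a * L 0 + V * 0) / 2"
  proof (rule le_right_limit_of_deriv_nonpos[where p = p and p' = p' and s = s])
    fix r :: real
    assume "0 < r"
    show "(p has_real_derivative p' r) (at r)"
      unfolding p_def p'_def
      by (rule derivative_eq_intros d refl | use \<open>0 < r\<close> in \<open>simp add: power2_eq_square\<close>)+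
    have "(L' r * r - L r) / r\<^sup>2 \<le> (a * L' r + V) / 2"
      using ineq[OF \<open>0 < r\<close>] \<open>0 < r\<close> by (simp add: pos_divide_le_eq mult.commute)
    then show "p' r \<le> 0" by (simp add: p'_def)
  next
    have "(L \<longlongrightarrow> L 0) (at_right 0)"
      using DERIV_isCont[OF d[of 0]] unfolding isCont_def
      by (rule filterlim_mono[OF _ order_refl at_le]) simp
    moreover have "((\<lambda>s. L s / s) \<longlongrightarrow> 0) (at_right 0)"
      using tendsto_quotient_deriv_0[of L] d[of 0] assms(2,3) by simp
    ultimately show "(p \<longlongrightarrow> 0 - (a * L 0 + V * 0) / 2) (at_right 0)"
      unfolding p_def by (intro tendsto_intros) simp_all
  qed fact
  then have "L s / s \<le> (a * L s + V * s) / 2"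
    using assms(2) by (simp add: p_def)
  then have "L s \<le> (a * L s + V * s) / 2 * s"
    by (rule pos_divide_le_eq[OF \<open>0 < s\<close>, THEN iffD1])
  also have "\<dots> = L s * (a * s / 2) + V * s\<^sup>2 / 2"
    by (simp add: algebra_simps power2_eq_square add_divide_distrib)
  finally show ?thesis by (simp add: right_diff_distrib)
qed

text \<open>
  Since \<open>Y' \<ge> 0\<close>, the hypothesis may be weakened to the case \<open>a = 1\<close>, where the differential
  inequality has the explicit extremal solution \<open>V * (s - 1 + exp (- s))\<close>.
\<close>

lemma lower_log_mgf_bound:
  fixes Y Y' :: "real \<Rightarrow> real"
  assumes d: "\<And>s. (Y has_real_derivative Y' s) (at s)"
    and "Y 0 = 0" "Y' 0 = 0" and Y': "\<And>s. 0 < s \<Longrightarrow> 0 \<le> Y' s"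
    and ineq: "\<And>s. 0 < s \<Longrightarrow> s * Y' s - Y s \<le> (exp s - s - 1) * (V - a * Y' s)"
    and "1 \<le> a" "0 \<le> V" "0 < s"
  shows "Y s \<le> V * s\<^sup>2 / 2"
proof -
  \<comment> \<open>For \<open>a = 1\<close> and equality, the linear equation has the particular
    solution \<open>V * s\<close> and the homogeneous solution \<open>1 - exp (- s)\<close>.
    Subtracting the first and dividing by the second yields a monotone quantity.\<close>
  define p where "p = (\<lambda>s. (Y s - V * s) / (1 - exp (- s)))"
  define p' where "p' = (\<lambda>s. ((Y' s - V) * (1 - exp (- s)) - (Y s - V * s) * exp (- s)) / (1 - exp (- s))\<^sup>2)"
  have "p s \<le> (0 - V) / 1"
  proof (rule le_right_limit_of_deriv_nonpos[where p = p and p' = p' and s = s])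
    fix s :: real
    assume "0 < s"
    then show "(p has_real_derivative p' s) (at s)"
      unfolding p_def p'_def
      by (auto intro!: derivative_eq_intros d simp: power2_eq_square)
    have "0 \<le> exp s - s - 1" using exp_ge_add_one_self[of s] by linarith
    then have "(exp s - s - 1) * (V - a * Y' s) \<le> (exp s - s - 1) * (V - 1 * Y' s)"
      using Y'[OF \<open>0 < s\<close>] \<open>1 \<le> a\<close> by (intro mult_left_mono diff_left_mono mult_right_mono)
    with ineq[OF \<open>0 < s\<close>] have "(Y' s - V) * (exp s - 1) - (Y s - V * s) \<le> 0"
      by (simp add: algebra_simps)
    \<comment> \<open>The factor \<open>exp (- s)\<close> turns the expression into the numerator of
      the quotient rule for \<open>p\<close>.\<close>
    then have "exp (- s) * ((Y' s - V) * (exp s - 1) - (Y s - V * s)) \<le> 0"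
      by (simp add: mult_le_0_iff)
    also have "exp (- s) * ((Y' s - V) * (exp s - 1) - (Y s - V * s)) =
        (Y' s - V) * (1 - exp (- s)) - (Y s - V * s) * exp (- s)"
      by (simp add: algebra_simps exp_minus)
    finally show "p' s \<le> 0" by (simp add: p'_def divide_nonpos_nonneg)
  next
    \<comment> \<open>Numerator and denominator of \<open>p\<close> both vanish at 0, so the limit
      of \<open>p\<close> is the quotient of their derivatives there.\<close>
    have "((\<lambda>s::real. 1 - exp (- s)) has_real_derivative 1) (at 0)"
      by (auto intro!: derivative_eq_intros)
    then have 1: "((\<lambda>s::real. (1 - exp (- s)) / s) \<longlongrightarrow> 1) (at_right 0)"
      by (rule tendsto_quotient_deriv_0) simp
    have "((\<lambda>s. Y s - V * s) has_real_derivative 0 - V) (at 0)"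
      using d[of 0] assms(3) by (auto intro!: derivative_eq_intros)
    then have 2: "((\<lambda>s. (Y s - V * s) / s) \<longlongrightarrow> 0 - V) (at_right 0)"
      by (rule tendsto_quotient_deriv_0) (simp add: assms(2))
    have "((\<lambda>s. ((Y s - V * s) / s) / ((1 - exp (- s)) / s)) \<longlongrightarrow> (0 - V) / 1) (at_right 0)"
      by (intro tendsto_divide 1 2) simp
    moreover have "\<forall>\<^sub>F s in at_right 0. ((Y s - V * s) / s) / ((1 - exp (- s)) / s) = p s"
      using eventually_at_right_less[of 0] by eventually_elim (simp add: p_def)
    ultimately show "(p \<longlongrightarrow> (0 - V) / 1) (at_right 0)"
      by (rule Lim_transform_eventually)
  qed fact
  then have "Y s \<le> V * (exp (- s) + s - 1)"
    using \<open>0 < s\<close> by (simp add: p_def field_simps)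
  also have "\<dots> \<le> V * (s\<^sup>2 / 2)"
    using exp_minus_le_quadratic[of s] \<open>0 < s\<close> \<open>0 \<le> V\<close> by (intro mult_left_mono) auto
  finally show ?thesis by simp
qed

text \<open>Let \<open>\<epsilon>\<close> tend to 0 from the right. For \<open>d = 0\<close> the
  exponent tends to minus infinity, so the limit is 0, which is exactly the convention in
  \<open>tail_bound\<close>.\<close>

lemma le_tail_bound_of_eps:
  assumes "0 < t" "0 \<le> d" and p: "\<And>\<epsilon>. 0 < \<epsilon> \<Longrightarrow> p \<le> exp (- t\<^sup>2 / (2 * (d + \<epsilon>)))"
  shows "p \<le> tail_bound t d"
proof -
  have ev: "\<forall>\<^sub>F \<epsilon> in at_right 0. p \<le> exp (- t\<^sup>2 / (2 * (d + \<epsilon>)))"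
    using eventually_at_right_less[of 0] by eventually_elim (rule p)
  have "((\<lambda>\<epsilon>. exp (- t\<^sup>2 / (2 * (d + \<epsilon>)))) \<longlongrightarrow> tail_bound t d) (at_right 0)"
  proof (cases "d = 0")
    case True
    have "filterlim (\<lambda>\<epsilon>. - t\<^sup>2 / (2 * \<epsilon>)) at_bot (at_right 0)"
      using \<open>0 < t\<close> by real_asymp
    then show ?thesis
      using True by (auto simp: tail_bound_def intro: filterlim_compose[OF exp_at_bot])
  next
    case False
    then have "((\<lambda>\<epsilon>. exp (- t\<^sup>2 / (2 * (d + \<epsilon>)))) \<longlongrightarrow> exp (- t\<^sup>2 / (2 * (d + 0)))) (at_right 0)"
      by (intro tendsto_intros) auto
    then show ?thesis using False by (simp add: tail_bound_def)
  qed
  then show ?thesis using ev by (rule tendsto_lowerbound) simp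
qed

subsection \<open>Bounded measurable functions\<close>

text \<open>A class closed under the algebraic operations, \<open>exp\<close>, sections and partial
  integrals, and contained in the integrable functions of any probability space. Integrability
  conditions thus reduce to the syntactic rules \<open>bm_intros\<close>.\<close>

definition bounded_measurable :: "'a measure \<Rightarrow> ('a \<Rightarrow> real) \<Rightarrow> bool"
  where "bounded_measurable N f \<longleftrightarrow> f \<in> borel_measurable N \<and> (\<exists>B. \<forall>x\<in>space N. \<bar>f x\<bar> \<le> B)"

lemma bounded_measurableI:
  assumes "f \<in> borel_measurable N" "\<And>x. x \<in> space N \<Longrightarrow> \<bar>f x\<bar> \<le> B"
  shows "bounded_measurable N f"
  using assms by (auto simp: bounded_measurable_def)

lemma bounded_measurable_measurable [dest]:
  "bounded_measurable N f \<Longrightarrow> f \<in> borel_measurable N"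
  by (simp add: bounded_measurable_def)

named_theorems bm_intros

lemma bounded_measurable_const [bm_intros]: "bounded_measurable N (\<lambda>x. c)"
  by (auto simp: bounded_measurable_def)

lemma bounded_measurable_add [bm_intros]:
  assumes "bounded_measurable N f" "bounded_measurable N g"
  shows "bounded_measurable N (\<lambda>x. f x + g x)"
proof -
  obtain A B where "\<forall>x\<in>space N. \<bar>f x\<bar> \<le> A" "\<forall>x\<in>space N. \<bar>g x\<bar> \<le> B"
    using assms by (auto simp: bounded_measurable_def)
  then show ?thesis
    using assms by (intro bounded_measurableI[where B = "A + B"]) fastforce+
qed

lemma bounded_measurable_mult [bm_intros]:
  assumes "bounded_measurable N f" "bounded_measurable N g"
  shows "bounded_measurable N (\<lambda>x. f x * g x)"
proof -
  obtain A B where AB: "\<forall>x\<in>space N. \<bar>f x\<bar> \<le> A" "\<forall>x\<in>space N. \<bar>g x\<bar> \<le> B"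
    using assms by (auto simp: bounded_measurable_def)
  have "\<bar>f x * g x\<bar> \<le> A * B" if "x \<in> space N" for x
    unfolding abs_mult using AB that by (intro mult_mono') auto
  moreover have "(\<lambda>x. f x * g x) \<in> borel_measurable N"
    using assms by (intro borel_measurable_times) auto
  ultimately show ?thesis by (intro bounded_measurableI)
qed

lemma bounded_measurable_diff [bm_intros]:
  assumes "bounded_measurable N f" "bounded_measurable N g"
  shows "bounded_measurable N (\<lambda>x. f x - g x)"
  using bounded_measurable_add[OF assms(1) bounded_measurable_mult[OF bounded_measurable_const[of N "- 1"] assms(2)]]
  by simp

lemma bounded_measurable_exp [bm_intros]:
  assumes "bounded_measurable N f"
  shows "bounded_measurable N (\<lambda>x. exp (f x))"
proof -
  obtain A where "\<forall>x\<in>space N. \<bar>f x\<bar> \<le> A"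
    using assms by (auto simp: bounded_measurable_def)
  moreover have "(\<lambda>x. exp (f x)) \<in> borel_measurable N"
    using assms by auto
  ultimately show ?thesis
    by (intro bounded_measurableI[where B = "exp A"]) fastforce+
qed

lemma bounded_measurable_sum [bm_intros]:
  "(\<And>k. k \<in> S \<Longrightarrow> bounded_measurable N (f k)) \<Longrightarrow> bounded_measurable N (\<lambda>x. \<Sum>k\<in>S. f k x)"
  by (induction S rule: infinite_finite_induct) (auto intro!: bm_intros)

lemma bounded_measurable_compose:
  assumes "bounded_measurable N' f" "\<phi> \<in> measurable N N'"
  shows "bounded_measurable N (\<lambda>x. f (\<phi> x))"
proof -
  obtain A where "\<forall>x\<in>space N'. \<bar>f x\<bar> \<le> A"
    using assms by (auto simp: bounded_measurable_def)
  moreover have "(\<lambda>x. f (\<phi> x)) \<in> borel_measurable N"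
    using assms by auto
  ultimately show ?thesis
    using measurable_space[OF assms(2)] by (intro bounded_measurableI[where B = A]) auto
qed

lemma integrable_bounded_measurable:
  assumes "prob_space M" "bounded_measurable M f"
  shows "integrable M f"
proof -
  interpret prob_space M by fact
  obtain B where "\<forall>x\<in>space M. \<bar>f x\<bar> \<le> B"
    using assms by (auto simp: bounded_measurable_def)
  then show ?thesis
    using assms by (intro integrable_const_bound[where B = B]) auto
qed

lemma bounded_measurable_integral:
  assumes "prob_space M" and f: "bounded_measurable (N \<Otimes>\<^sub>M M) (\<lambda>(x, y). f x y)"
  shows "bounded_measurable N (\<lambda>x. \<integral>y. f x y \<partial>M)"
proof -
  interpret prob_space M by fact
  obtain B where B: "\<And>x y. x \<in> space N \<Longrightarrow> y \<in> space M \<Longrightarrow> \<bar>f x y\<bar> \<le> B"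
    using f by (auto simp: bounded_measurable_def space_pair_measure)
  show ?thesis
  proof (rule bounded_measurableI)
    show "(\<lambda>x. \<integral>y. f x y \<partial>M) \<in> borel_measurable N"
      using f by (intro borel_measurable_lebesgue_integral) auto
    fix x assume x: "x \<in> space N"
    have "bounded_measurable M (f x)"
      using bounded_measurable_compose[OF f measurable_Pair1'[OF x]] by simp
    with assms(1) have "integrable M (\<lambda>y. \<bar>f x y\<bar>)"
      by (intro integrable_abs integrable_bounded_measurable)
    moreover have "AE y in M. \<bar>f x y\<bar> \<le> B"
      using B[OF x] by auto
    ultimately have "(\<integral>y. \<bar>f x y\<bar> \<partial>M) \<le> B"
      by (rule integral_le_const)
    with integral_abs_bound[of M "f x"] show "\<bar>\<integral>y. f x y \<partial>M\<bar> \<le> B"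
      by linarith
  qed
qed

section \<open>Moment generating function of a bounded function\<close>

lemma integral_exp_pos:
  assumes "prob_space M" "bounded_measurable M g"
  shows "0 < (\<integral>x. exp (g x) \<partial>M)"
proof -
  interpret prob_space M by fact
  obtain B where B: "\<forall>x\<in>space M. \<bar>g x\<bar> \<le> B"
    using assms by (auto simp: bounded_measurable_def)
  have "exp (- B) \<le> (\<integral>x. exp (g x) \<partial>M)"
    using B assms
    by (intro integral_ge_const integrable_bounded_measurable bm_intros) fastforce+
  then show ?thesis by (rule less_le_trans[rotated]) simp
qed

text \<open>For \<open>u \<ge> 0\<close> the inequality \<open>exp u - 1 \<le> u * exp u\<close> is
  applied twice; for negative \<open>u\<close> the quadratic bound suffices. It controls the error
  when differentiating under the integral.\<close>

lemma exp_remainder_le: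
  fixes u :: real
  shows "exp u - 1 - u \<le> u\<^sup>2 * exp \<bar>u\<bar>"
proof (cases "0 \<le> u")
  case True
  have "(1 - u) * exp u \<le> exp (- u) * exp u"
    using exp_ge_add_one_self[of "- u"] by (intro mult_right_mono) auto
  then have *: "exp u - 1 \<le> u * exp u"
    by (simp add: algebra_simps flip: exp_add)
  then have "u * (exp u - 1) \<le> u * (u * exp u)"
    using True by (intro mult_left_mono)
  with * True show ?thesis by (simp add: algebra_simps power2_eq_square)
next
  case False
  then have "exp u - 1 - u \<le> u\<^sup>2 / 2"
    using exp_minus_le_quadratic[of "- u"] by simp
  also have "\<dots> \<le> u\<^sup>2 * 1" by simp
  also have "\<dots> \<le> u\<^sup>2 * exp \<bar>u\<bar>" by (intro mult_left_mono) auto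
  finally show ?thesis .
qed

text \<open>The first-order Taylor remainder of \<open>F\<close> in \<open>h\<close> is the
  expectation of a pointwise remainder. As \<open>X\<close> is bounded, that remainder is of order
  \<open>h^2\<close> uniformly on the space, so after division by \<open>h\<close> it vanishes in
  the limit.\<close>

lemma mgf_has_derivative:
  assumes "prob_space M" and X: "bounded_measurable M X"
  shows "((\<lambda>s. \<integral>x. exp (s * X x) \<partial>M) has_real_derivative (\<integral>x. X x * exp (s * X x) \<partial>M)) (at s)"
proof -
  interpret prob_space M by fact
  obtain B where B: "\<And>x. x \<in> space M \<Longrightarrow> \<bar>X x\<bar> \<le> B"
    using X by (auto simp: bounded_measurable_def)
  define F where "F = (\<lambda>s. expectation (\<lambda>x. exp (s * X x)))"
  define D where "D = expectation (\<lambda>x. X x * exp (s * X x))"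
  note int = integrable_bounded_measurable[OF assms(1)] bm_intros X
  have R: "F (s + h) - F s - h * D =
      expectation (\<lambda>x. exp (s * X x) * (exp (h * X x) - 1 - h * X x))" for h
  proof -
    have "exp (s * X x) * (exp (h * X x) - 1 - h * X x) =
        exp ((s + h) * X x) - exp (s * X x) - h * (X x * exp (s * X x))" for x
      by (simp add: algebra_simps exp_add)
    then show ?thesis
      unfolding F_def D_def by (simp add: int)
  qed
  have le: "\<bar>F (s + h) - F s - h * D\<bar> \<le> exp (\<bar>s\<bar> * B) * (h\<^sup>2 * B\<^sup>2 * exp (\<bar>h\<bar> * B))" for h
  proof -
    have "\<bar>F (s + h) - F s - h * D\<bar> \<le> expectation (\<lambda>x. \<bar>exp (s * X x) * (exp (h * X x) - 1 - h * X x)\<bar>)"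
      unfolding R by (rule integral_abs_bound)
    also have "\<dots> \<le> exp (\<bar>s\<bar> * B) * (h\<^sup>2 * B\<^sup>2 * exp (\<bar>h\<bar> * B))"
    proof (rule integral_le_const)
      show "integrable M (\<lambda>x. \<bar>exp (s * X x) * (exp (h * X x) - 1 - h * X x)\<bar>)"
        by (intro integrable_abs int)
      have "\<bar>exp (s * X x) * (exp (h * X x) - 1 - h * X x)\<bar> \<le> exp (\<bar>s\<bar> * B) * (h\<^sup>2 * B\<^sup>2 * exp (\<bar>h\<bar> * B))"
        if x: "x \<in> space M" for x
      proof -
        have a: "\<bar>r * X x\<bar> \<le> \<bar>r\<bar> * B" for r
          unfolding abs_mult using B[OF x] by (intro mult_left_mono) auto
        have "0 \<le> B" using B[OF x] by linarith
        have 1: "exp (s * X x) \<le> exp (\<bar>s\<bar> * B)" using a[of s] by simp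
        have 0: "0 \<le> exp (h * X x) - 1 - h * X x"
          using exp_ge_add_one_self[of "h * X x"] by linarith
        have "exp (h * X x) - 1 - h * X x \<le> \<bar>h * X x\<bar>\<^sup>2 * exp \<bar>h * X x\<bar>"
          using exp_remainder_le[of "h * X x"] by simp
        also have "\<dots> \<le> (\<bar>h\<bar> * B)\<^sup>2 * exp (\<bar>h\<bar> * B)"
          using a[of h] \<open>0 \<le> B\<close> by (intro mult_mono power_mono) auto
        finally have 2: "exp (h * X x) - 1 - h * X x \<le> h\<^sup>2 * B\<^sup>2 * exp (\<bar>h\<bar> * B)"
          by (simp add: power_mult_distrib)
        show ?thesis
          unfolding abs_mult using 0 1 2 by (intro mult_mono) auto
      qed
      then show "AE x in M. \<bar>exp (s * X x) * (exp (h * X x) - 1 - h * X x)\<bar> \<le> exp (\<bar>s\<bar> * B) * (h\<^sup>2 * B\<^sup>2 * exp (\<bar>h\<bar> * B))"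
        by auto
    qed
    finally show ?thesis .
  qed
  have "((\<lambda>h. exp (\<bar>s\<bar> * B) * (\<bar>h\<bar> * B\<^sup>2 * exp (\<bar>h\<bar> * B))) \<longlongrightarrow> exp (\<bar>s\<bar> * B) * (\<bar>0\<bar> * B\<^sup>2 * exp (\<bar>0\<bar> * B))) (at 0)"
    by (intro tendsto_intros)
  then have lim: "((\<lambda>h. exp (\<bar>s\<bar> * B) * (\<bar>h\<bar> * B\<^sup>2 * exp (\<bar>h\<bar> * B))) \<longlongrightarrow> 0) (at 0)"
    by simp
  have "((\<lambda>h. (F (s + h) - F s) / h - D) \<longlongrightarrow> 0) (at 0)"
  proof (rule Lim_null_comparison[OF _ lim])
    show "\<forall>\<^sub>F h in at 0. norm ((F (s + h) - F s) / h - D) \<le> exp (\<bar>s\<bar> * B) * (\<bar>h\<bar> * B\<^sup>2 * exp (\<bar>h\<bar> * B))"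
      using eventually_neq_at_within[of 0 0 UNIV]
    proof eventually_elim
      case (elim h)
      then have "norm ((F (s + h) - F s) / h - D) = \<bar>F (s + h) - F s - h * D\<bar> / \<bar>h\<bar>"
        by (simp add: abs_divide[symmetric] diff_divide_distrib)
      also have "\<dots> \<le> exp (\<bar>s\<bar> * B) * (h\<^sup>2 * B\<^sup>2 * exp (\<bar>h\<bar> * B)) / \<bar>h\<bar>"
        by (intro divide_right_mono le) simp
      also have "\<dots> = exp (\<bar>s\<bar> * B) * (\<bar>h\<bar> * B\<^sup>2 * exp (\<bar>h\<bar> * B))"
        using elim by (simp add: power2_eq_square abs_if)
      finally show "norm ((F (s + h) - F s) / h - D) \<le> exp (\<bar>s\<bar> * B) * (\<bar>h\<bar> * B\<^sup>2 * exp (\<bar>h\<bar> * B))" .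
    qed
  qed
  then show ?thesis
    unfolding DERIV_def F_def[symmetric] D_def[symmetric] by (rule LIM_zero_cancel)
qed

section \<open>Sections and iterated integrals over a product\<close>

lemma bounded_measurable_section:
  fixes f :: "('i \<Rightarrow> 'a) \<Rightarrow> real"
  assumes "i \<notin> J" and f: "bounded_measurable (PiM (insert i J) M) f"
  shows "bounded_measurable (PiM J M \<Otimes>\<^sub>M M i) (\<lambda>(x, y). f (x(i := y)))"
    and "bounded_measurable (M i \<Otimes>\<^sub>M PiM J M) (\<lambda>(y, x). f (x(i := y)))"
    and "x \<in> space (PiM J M) \<Longrightarrow> bounded_measurable (M i) (\<lambda>y. f (x(i := y)))"
    and "y \<in> space (M i) \<Longrightarrow> bounded_measurable (PiM J M) (\<lambda>x. f (x(i := y)))"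
proof -
  show 1: "bounded_measurable (PiM J M \<Otimes>\<^sub>M M i) (\<lambda>(x, y). f (x(i := y)))"
    using bounded_measurable_compose[OF f measurable_add_dim] by (simp add: case_prod_unfold)
  show "bounded_measurable (M i \<Otimes>\<^sub>M PiM J M) (\<lambda>(y, x). f (x(i := y)))"
    using bounded_measurable_compose[OF 1 measurable_pair_swap'] by (simp add: case_prod_unfold)
  show "bounded_measurable (M i) (\<lambda>y. f (x(i := y)))" if "x \<in> space (PiM J M)"
    using bounded_measurable_compose[OF 1 measurable_Pair1'[OF that]] by simp
  show "bounded_measurable (PiM J M) (\<lambda>x. f (x(i := y)))" if "y \<in> space (M i)"
    using bounded_measurable_compose[OF 1 measurable_Pair2'[OF that]] by simp
qed

subsection \<open>Subadditivity of entropy\<close>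

text \<open>Fubini with the new coordinate outermost, so that an induction hypothesis over
  \<open>J\<close> can be applied to the inner integral for each fixed \<open>y\<close>.\<close>

lemma product_integral_insert_rev:
  fixes M :: "'i \<Rightarrow> 'a measure" and f :: "('i \<Rightarrow> 'a) \<Rightarrow> real"
  assumes prob: "\<And>k. prob_space (M k)"
    and "finite J" "i \<notin> J" and f: "bounded_measurable (PiM (insert i J) M) f"
  shows "integral\<^sup>L (PiM (insert i J) M) f = (\<integral>y. (\<integral>x. f (x(i := y)) \<partial>PiM J M) \<partial>M i)"
proof -
  interpret M: prob_space "M k" for k by (rule prob)
  interpret product_sigma_finite M ..
  interpret P: prob_space "PiM J M" by (rule prob_space_PiM[OF prob])
  interpret Q: prob_space "PiM (insert i J) M" by (rule prob_space_PiM[OF prob])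
  note Q_integrable = integrable_bounded_measurable[OF Q.prob_space_axioms]
  interpret PP: pair_prob_space "PiM J M" "M i" ..
  have "integral\<^sup>L (PiM (insert i J) M) f = (\<integral>x. (\<integral>y. f (x(i := y)) \<partial>M i) \<partial>PiM J M)"
    by (rule product_integral_insert[OF assms(2,3) Q_integrable[OF f]])
  also have "\<dots> = (\<integral>y. (\<integral>x. f (x(i := y)) \<partial>PiM J M) \<partial>M i)"
    by (rule PP.Fubini_integral[symmetric, OF integrable_bounded_measurable[OF PP.prob_space_axioms]])
       (rule bounded_measurable_section(1)[OF \<open>i \<notin> J\<close> f])
  finally show ?thesis .
qed

text \<open>
  Subadditivity of entropy combined with its variational formula
  \<open>Ent G = (INF c. E [G * ln (G / c) - G + c])\<close>, for \<open>G = exp g\<close>: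
  in each coordinate \<open>k\<close> any competitor \<open>exp (c k)\<close> not depending on that coordinate is allowed.
\<close>

lemma entropy_subadditive:
  fixes M :: "'i \<Rightarrow> 'a measure" and g :: "('i \<Rightarrow> 'a) \<Rightarrow> real"
  assumes prob: "\<And>k. prob_space (M k)"
    and "finite J" and "bounded_measurable (PiM J M) g"
    and "\<And>k. k \<in> J \<Longrightarrow> bounded_measurable (PiM J M) (c k)"
    and "\<And>k x y. k \<in> J \<Longrightarrow> x \<in> space (PiM J M) \<Longrightarrow> y \<in> space (M k) \<Longrightarrow> c k (x(k := y)) = c k x"
  shows "(\<integral>x. g x * exp (g x) \<partial>PiM J M) - (\<integral>x. exp (g x) \<partial>PiM J M) * ln (\<integral>x. exp (g x) \<partial>PiM J M)
    \<le> (\<Sum>k\<in>J. \<integral>x. exp (g x) * (g x - c k x - 1) + exp (c k x) \<partial>PiM J M)"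
  using assms(2-)
\<comment> \<open>\<open>g\<close> and \<open>c\<close> vary because the induction hypothesis is
  applied to their sections at a fixed value of the coordinate \<open>i\<close>.\<close>
proof (induction J arbitrary: g c rule: finite_induct)
  case empty
  \<comment> \<open>The empty product is a point mass, under which the entropy is 0.\<close>
  have "integral\<^sup>L (PiM {} M) f = f (\<lambda>_. undefined)" for f :: "('i \<Rightarrow> 'a) \<Rightarrow> real"
    by (simp add: PiM_empty lebesgue_integral_count_space_finite)
  then show ?case by simp
next
  case (insert i J)
  let ?P = "PiM J M" and ?Q = "PiM (insert i J) M"
  interpret M: prob_space "M k" for k by (rule prob)
  interpret product_sigma_finite M ..
  interpret P: prob_space ?P by (rule prob_space_PiM[OF prob])
  interpret Q: prob_space ?Q by (rule prob_space_PiM[OF prob])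
  note P_integrable = integrable_bounded_measurable[OF P.prob_space_axioms]
  note Q_integrable = integrable_bounded_measurable[OF Q.prob_space_axioms]
  note g = insert.prems(1) and c = insert.prems(2) and inv = insert.prems(3)
  note iJ = insert.hyps(1,2)
  note sec = bounded_measurable_section[OF iJ(2)]
  note rev = product_integral_insert_rev[OF prob iJ]
  have fwd: "integral\<^sup>L ?Q f = (\<integral>x. (\<integral>y. f (x(i := y)) \<partial>M i) \<partial>?P)"
    if "bounded_measurable ?Q f" for f :: "('i \<Rightarrow> 'a) \<Rightarrow> real"
    by (rule product_integral_insert[OF iJ Q_integrable[OF that]])
  have int1: "bounded_measurable (M i) (\<lambda>y. \<integral>x. f (x(i := y)) \<partial>?P)"
    if "bounded_measurable ?Q f" for f :: "('i \<Rightarrow> 'a) \<Rightarrow> real"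
    using sec(2)[OF that] by (rule bounded_measurable_integral[OF P.prob_space_axioms])
  define z where "z = (\<integral>x. exp (g x) \<partial>?Q)"
  \<comment> \<open>\<open>h\<close> is \<open>exp g\<close> with the coordinates in
    \<open>J\<close> integrated out. The entropy splits by the chain rule into the mean entropy of
    the sections over \<open>J\<close> and the entropy of \<open>h\<close> under
    \<open>M i\<close>.\<close>
  define h where "h = (\<lambda>y. \<integral>x. exp (g (x(i := y))) \<partial>?P)"
  have h_eq: "(\<integral>x. exp (g (x(i := y))) \<partial>?P) = h y" for y
    by (simp add: h_def)
  define T where "T = (\<lambda>k x. exp (g x) * (g x - c k x - 1) + exp (c k x))"
  have T: "bounded_measurable ?Q (T k)" if "k \<in> insert i J" for k
    unfolding T_def using that by (intro bm_intros g c)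
  have z: "0 < z" unfolding z_def by (rule integral_exp_pos[OF Q.prob_space_axioms g])
  have h_bm: "bounded_measurable (M i) h"
    unfolding h_def by (rule int1) (intro bm_intros g)
  have z_h: "z = integral\<^sup>L (M i) h"
    unfolding z_def h_def by (rule rev) (intro bm_intros g)
  obtain B where B: "\<And>x. x \<in> space ?Q \<Longrightarrow> \<bar>g x\<bar> \<le> B"
    using g by (auto simp: bounded_measurable_def)
  have upd: "x(i := y) \<in> space ?Q" if "x \<in> space ?P" "y \<in> space (M i)" for x y
    using that by (auto simp: space_PiM PiE_iff extensional_def)
  \<comment> \<open>The lower bound keeps \<open>h\<close> away from 0, so that
    \<open>ln (h y)\<close> is bounded too.\<close>
  have h_bounds: "exp (- B) \<le> h y" "h y \<le> exp B" if "y \<in> space (M i)" for y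
  proof -
    have "integrable ?P (\<lambda>x. exp (g (x(i := y))))"
      by (intro P_integrable bm_intros sec(4) g that)
    moreover have "AE x in ?P. exp (- B) \<le> exp (g (x(i := y)))" "AE x in ?P. exp (g (x(i := y))) \<le> exp B"
      using B[OF upd[OF _ that]] by (auto intro!: AE_I2 simp: abs_le_iff minus_le_iff)
    ultimately show "exp (- B) \<le> h y" "h y \<le> exp B"
      unfolding h_def by (auto intro: P.integral_ge_const P.integral_le_const)
  qed
  have h_pos: "0 < h y" if "y \<in> space (M i)" for y
    using h_bounds(1)[OF that] by (rule less_le_trans[rotated]) simp
  have lnh_bm: "bounded_measurable (M i) (\<lambda>y. ln (h y))"
  proof (rule bounded_measurableI)
    show "(\<lambda>y. ln (h y)) \<in> borel_measurable (M i)"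
      using h_bm by auto
    fix y assume y: "y \<in> space (M i)"
    have "- B \<le> ln (h y)" "ln (h y) \<le> B"
      using h_bounds[OF y] h_pos[OF y] ln_ge_iff[of "h y" "- B"] ln_le_cancel_iff[of "h y" "exp B"]
      by simp_all
    then show "\<bar>ln (h y)\<bar> \<le> B" by simp
  qed

  \<comment> \<open>First part of the chain rule: for each \<open>y\<close> the induction hypothesis
    bounds the entropy of the section, and the bounds are integrated over \<open>y\<close>.\<close>
  have "(\<integral>x. g x * exp (g x) \<partial>?Q) - (\<integral>y. h y * ln (h y) \<partial>M i)
      = (\<integral>y. (\<integral>x. g (x(i := y)) * exp (g (x(i := y))) \<partial>?P) - h y * ln (h y) \<partial>M i)"
  proof -
    have *: "bounded_measurable ?Q (\<lambda>x. g x * exp (g x))" by (intro bm_intros g)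
    show ?thesis
      unfolding rev[OF *]
      by (intro Bochner_Integration.integral_diff[symmetric] integrable_bounded_measurable[OF prob] bm_intros
          int1[OF *] h_bm lnh_bm)
  qed
  also have "\<dots> \<le> (\<integral>y. (\<Sum>k\<in>J. \<integral>x. T k (x(i := y)) \<partial>?P) \<partial>M i)"
  proof (rule integral_mono)
    show "integrable (M i) (\<lambda>y. (\<integral>x. g (x(i := y)) * exp (g (x(i := y))) \<partial>?P) - h y * ln (h y))"
      using int1[of "\<lambda>x. g x * exp (g x)"]
      by (intro integrable_bounded_measurable[OF prob] bm_intros h_bm lnh_bm) (simp add: bm_intros g)
    show "integrable (M i) (\<lambda>y. \<Sum>k\<in>J. \<integral>x. T k (x(i := y)) \<partial>?P)"
      by (intro integrable_bounded_measurable[OF prob] bm_intros int1 T) simp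
    fix y assume y: "y \<in> space (M i)"
    show "(\<integral>x. g (x(i := y)) * exp (g (x(i := y))) \<partial>?P) - h y * ln (h y) \<le> (\<Sum>k\<in>J. \<integral>x. T k (x(i := y)) \<partial>?P)"
      unfolding T_def h_def
    proof (rule insert.IH)
      show "bounded_measurable ?P (\<lambda>x. g (x(i := y)))" by (rule sec(4)[OF g y])
      fix k assume k: "k \<in> J"
      then show "bounded_measurable ?P (\<lambda>x. c k (x(i := y)))" by (intro sec(4)[OF c y]) simp
      fix x v assume "x \<in> space ?P" "v \<in> space (M k)"
      then have "c k ((x(i := y))(k := v)) = c k (x(i := y))"
        using k by (intro inv upd y) auto
      then show "c k ((x(k := v))(i := y)) = c k (x(i := y))"
        using k iJ by (subst fun_upd_twist) auto
    qed
  qed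
  also have "\<dots> = (\<Sum>k\<in>J. integral\<^sup>L ?Q (T k))"
    by (subst Bochner_Integration.integral_sum)
       (auto intro!: integrable_bounded_measurable[OF prob] int1 T sum.cong rev[symmetric])
  finally have 1: "(\<integral>x. g x * exp (g x) \<partial>?Q) - (\<integral>y. h y * ln (h y) \<partial>M i) \<le> (\<Sum>k\<in>J. integral\<^sup>L ?Q (T k))" .

  have hi: "bounded_measurable ?Q (\<lambda>x. h (x i))" "bounded_measurable ?Q (\<lambda>x. ln (h (x i)))"
    using bounded_measurable_compose[OF h_bm, of "\<lambda>x. x i" ?Q]
      bounded_measurable_compose[OF lnh_bm, of "\<lambda>x. x i" ?Q] by auto
  have ci: "bounded_measurable ?Q (c i)" using c by simp
  \<comment> \<open>Second part: the entropy of \<open>h\<close> is rewritten over the full product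
    with weight \<open>exp (g x)\<close>, where it can be compared with \<open>c i\<close>.\<close>
  have "(\<integral>y. h y * ln (h y) \<partial>M i) - z * ln z = (\<integral>y. h y * (ln (h y) - ln z) \<partial>M i)"
    unfolding right_diff_distrib z_h
    by (subst Bochner_Integration.integral_diff)
       (auto intro!: integrable_bounded_measurable[OF prob] bm_intros h_bm lnh_bm)
  also have "\<dots> = (\<integral>x. exp (g x) * (ln (h (x i)) - ln z) \<partial>?Q)"
    by (subst rev) (auto intro!: bm_intros g hi simp: h_eq)
  also have "\<dots> \<le> (\<integral>x. exp (g x) * (g x - c i x - 1) + exp (c i x) * (h (x i) / z) \<partial>?Q)"
  proof (rule integral_mono)
    have bz: "bounded_measurable ?Q (\<lambda>x. h (x i) / z)"
      using bounded_measurable_mult[OF hi(1) bounded_measurable_const[of _ "1 / z"]] by simp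
    show "integrable ?Q (\<lambda>x. exp (g x) * (ln (h (x i)) - ln z))"
      by (intro Q_integrable bm_intros g hi)
    show "integrable ?Q (\<lambda>x. exp (g x) * (g x - c i x - 1) + exp (c i x) * (h (x i) / z))"
      by (intro Q_integrable bm_intros g ci bz)
    fix x assume "x \<in> space ?Q"
    then have hx: "0 < h (x i)" by (intro h_pos) (auto simp: space_PiM)
    \<comment> \<open>With this choice, \<open>ln ?u \<le> ?u - 1\<close> multiplied by
      \<open>exp (g x)\<close> gives the integrand bound; the factor \<open>exp (g x)\<close>
      cancels in front of \<open>?u\<close>.\<close>
    let ?u = "exp (c i x - g x) * (h (x i) / z)"
    have "ln ?u = c i x - g x + (ln (h (x i)) - ln z)"
      using hx z by (simp add: ln_mult ln_div)
    moreover have "ln ?u \<le> ?u - 1"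
      using hx z by (intro ln_le_minus_one) simp
    ultimately have "exp (g x) * (ln (h (x i)) - ln z) \<le> exp (g x) * (g x - c i x - 1 + ?u)"
      by (intro mult_left_mono) auto
    also have "\<dots> = exp (g x) * (g x - c i x - 1) + exp (c i x) * (h (x i) / z)"
      by (simp add: distrib_left exp_diff)
    finally show "exp (g x) * (ln (h (x i)) - ln z) \<le> exp (g x) * (g x - c i x - 1) + exp (c i x) * (h (x i) / z)" .
  qed
  also have "\<dots> = integral\<^sup>L ?Q (T i)"
  proof -
    \<comment> \<open>Since \<open>c i\<close> ignores the coordinate \<open>i\<close>, it may be
      frozen at \<open>y0\<close>. The factor \<open>h y / z\<close> then integrates to 1 separately
      and drops out.\<close>
    obtain y0 where y0: "y0 \<in> space (M i)" using M.not_empty by blast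
    have ciy: "c i (x(i := y)) = c i (x(i := y0))" if "x \<in> space ?P" "y \<in> space (M i)" for x y
      using inv[OF insertI1 upd[OF that(1) y0] that(2)] by (simp only: fun_upd_upd)
    have bz: "bounded_measurable (M i) (\<lambda>y. h y / z)"
      using bounded_measurable_mult[OF h_bm bounded_measurable_const[of _ "1 / z"]] by simp
    have bz': "bounded_measurable ?Q (\<lambda>x. h (x i) / z)"
      using bounded_measurable_mult[OF hi(1) bounded_measurable_const[of _ "1 / z"]] by simp
    have "(\<integral>x. exp (c i x) * (h (x i) / z) \<partial>?Q) = (\<integral>x. (\<integral>y. exp (c i (x(i := y))) * (h y / z) \<partial>M i) \<partial>?P)"
      unfolding fwd[OF bounded_measurable_mult[OF bounded_measurable_exp[OF ci] bz']] by simp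
    also have "\<dots> = (\<integral>x. (\<integral>y. exp (c i (x(i := y0))) * (h y / z) \<partial>M i) \<partial>?P)"
      by (intro Bochner_Integration.integral_cong refl) (simp add: ciy)
    also have "\<dots> = (\<integral>x. exp (c i (x(i := y0))) \<partial>?P)"
      using z by (simp add: z_h)
    also have "\<dots> = (\<integral>x. (\<integral>y. exp (c i (x(i := y0))) \<partial>M i) \<partial>?P)"
      by (simp add: M.prob_space)
    also have "\<dots> = (\<integral>x. (\<integral>y. exp (c i (x(i := y))) \<partial>M i) \<partial>?P)"
      by (intro Bochner_Integration.integral_cong refl) (metis ciy)
    also have "\<dots> = (\<integral>x. exp (c i x) \<partial>?Q)"
      by (subst fwd) (auto intro!: bm_intros ci)
    finally show ?thesis
      unfolding T_def
      by (subst (1 2) Bochner_Integration.integral_add)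
         ((intro Q_integrable bm_intros g ci bz')+, simp)
  qed
  finally have 2: "(\<integral>y. h y * ln (h y) \<partial>M i) - z * ln z \<le> integral\<^sup>L ?Q (T i)" .
  show ?case
    using 1 2 iJ unfolding z_def[symmetric] T_def by simp
qed

subsection \<open>Functions with self-bounded variance proxy\<close>

lemma space_PiM_update:
  assumes "x \<in> space (PiM J M)" "k \<in> J" "y \<in> space (M k)"
  shows "x(k := y) \<in> space (PiM J M)"
  using assms by (auto simp: space_PiM PiE_iff extensional_def)

text \<open>This invariance makes the coordinatewise infimum an admissible competitor in
  \<open>entropy_subadditive\<close>.\<close>

lemma inf_coord_update [simp]: "inf_coord M k f (x(k := y)) = inf_coord M k f x"
  by (simp add: inf_coord_def)

text \<open>Take \<open>y = x k\<close> in the infimum; boundedness of \<open>f\<close> supplies the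
  lower bound that a real infimum requires.\<close>

lemma inf_coord_le:
  fixes M :: "nat \<Rightarrow> 'a measure"
  assumes "k \<in> J" and f: "bounded_measurable (PiM J M) f" and x: "x \<in> space (PiM J M)"
  shows "inf_coord M k f x \<le> f x"
proof -
  obtain B where B: "\<And>x. x \<in> space (PiM J M) \<Longrightarrow> \<bar>f x\<bar> \<le> B"
    using f by (auto simp: bounded_measurable_def)
  have "- B \<le> f (x(k := y))" if "y \<in> space (M k)" for y
    using B[OF space_PiM_update[OF x \<open>k \<in> J\<close> that]] by linarith
  then have "bdd_below ((\<lambda>y. f (x(k := y))) ` space (M k))" by (intro bdd_belowI2)
  moreover have "x k \<in> space (M k)" using x \<open>k \<in> J\<close> by (auto simp: space_PiM)
  ultimately have "inf_coord M k f x \<le> f (x(k := x k))"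
    unfolding inf_coord_def by (rule cINF_lower)
  then show ?thesis by simp
qed

lemma bounded_measurable_inf_coord:
  fixes M :: "nat \<Rightarrow> 'a measure"
  assumes "k \<in> J" "space (M k) \<noteq> {}" and f: "bounded_measurable (PiM J M) f"
    and "inf_coord M k f \<in> borel_measurable (PiM J M)"
  shows "bounded_measurable (PiM J M) (inf_coord M k f)"
proof -
  obtain B where B: "\<And>x. x \<in> space (PiM J M) \<Longrightarrow> \<bar>f x\<bar> \<le> B"
    using f by (auto simp: bounded_measurable_def)
  have "\<bar>inf_coord M k f x\<bar> \<le> B" if x: "x \<in> space (PiM J M)" for x
  proof -
    have "- B \<le> f (x(k := y))" if "y \<in> space (M k)" for y
      using B[OF space_PiM_update[OF x \<open>k \<in> J\<close> that]] by linarith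
    then have "- B \<le> inf_coord M k f x"
      unfolding inf_coord_def using assms(2) by (intro cINF_greatest) auto
    moreover have "inf_coord M k f x \<le> B"
      using inf_coord_le[OF \<open>k \<in> J\<close> f x] B[OF x] by linarith
    ultimately show ?thesis by simp
  qed
  with assms(4) show ?thesis by (rule bounded_measurableI)
qed

text \<open>Markov's inequality for \<open>exp (s * X)\<close>. The value \<open>s = t / D\<close>
  minimizes the exponent \<open>D * s^2 / 2 - s * t\<close>.\<close>

lemma chernoff_bound:
  assumes "prob_space M" and X: "bounded_measurable M X"
    and "0 < t" "0 < D" "s = t / D"
    and bound: "ln (\<integral>x. exp (s * X x) \<partial>M) \<le> D * s\<^sup>2 / 2"
  shows "measure M {x \<in> space M. t < X x} \<le> exp (- t\<^sup>2 / (2 * D))"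
proof -
  interpret prob_space M by fact
  let ?F = "expectation (\<lambda>x. exp (s * X x))"
  have sX: "bounded_measurable M (\<lambda>x. s * X x)" by (intro bm_intros X)
  have "0 < s" using assms by simp
  have "prob {x \<in> space M. t < X x} \<le> prob {x \<in> space M. t \<le> X x}"
    using X by (intro finite_measure_mono) auto
  also have "\<dots> \<le> exp (- s * t) * (\<integral>x\<in>space M. exp (s * X x) \<partial>M)"
    using \<open>0 < s\<close> unfolding set_integrable_def
    by (intro Chernoff_ineq_ge[unfolded set_integrable_def] integrable_mult_indicator sets.top
        integrable_bounded_measurable assms(1) bounded_measurable_exp sX)
  also have "(\<integral>x\<in>space M. exp (s * X x) \<partial>M) = exp (ln ?F)"
    using integrable_bounded_measurable[OF assms(1) bounded_measurable_exp[OF sX]] integral_exp_pos[OF assms(1) sX]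
    by (simp add: set_integral_space)
  also have "exp (- s * t) * exp (ln ?F) = exp (- s * t + ln ?F)" by (rule exp_add[symmetric])
  also have "\<dots> \<le> exp (- s * t + D * s\<^sup>2 / 2)" using bound by simp
  also have "- s * t + D * s\<^sup>2 / 2 = - t\<^sup>2 / (2 * D)"
    using \<open>0 < D\<close> by (simp add: \<open>s = t / D\<close> field_simps power2_eq_square)
  finally show ?thesis .
qed

text \<open>The sign of \<open>s\<close> matters only through the constant \<open>K\<close>, so one
  inequality serves both tails. Here \<open>W\<close> is the derivative of \<open>F\<close> in
  \<open>s\<close>; division by \<open>F\<close> later yields the differential inequality for
  \<open>ln F\<close>.\<close>

lemma entropy_le_of_variance_proxy:
  fixes M :: "nat \<Rightarrow> 'a measure" and n :: nat
  defines "N \<equiv> PiM {1..n} M"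
  assumes prob: "\<And>k. prob_space (M k)"
    and f: "bounded_measurable N f"
    and inf: "\<And>k. k \<in> {1..n} \<Longrightarrow> inf_coord M k f \<in> borel_measurable N"
    and Df: "\<And>x. x \<in> space N \<Longrightarrow> variance_proxy n M f x \<le> a * X x + V"
    and X: "X = (\<lambda>x. f x - m)"
    and "0 \<le> K"
    and K: "\<And>k x u. k \<in> {1..n} \<Longrightarrow> x \<in> space N \<Longrightarrow> u = f x - inf_coord M k f x \<Longrightarrow> 0 \<le> u \<Longrightarrow>
      exp (- (s * u)) + s * u - 1 \<le> K * u\<^sup>2"
  defines "F \<equiv> \<integral>x. exp (s * X x) \<partial>N" and "W \<equiv> \<integral>x. X x * exp (s * X x) \<partial>N"
  shows "s * W - F * ln F \<le> K * (a * W + V * F)"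
proof -
  interpret N: prob_space N unfolding N_def by (rule prob_space_PiM[OF prob])
  note N_integrable = integrable_bounded_measurable[OF N.prob_space_axioms]
  have inf_bm: "bounded_measurable N (inf_coord M k f)" if "k \<in> {1..n}" for k
    using that f inf[OF that] prob_space.not_empty[OF prob]
    unfolding N_def by (intro bounded_measurable_inf_coord) auto
  have X_bm: "bounded_measurable N X" unfolding X by (intro bm_intros f)
  \<comment> \<open>The shift by \<open>m\<close> matches that in \<open>X\<close>, so
    \<open>s * X x - ?c k x\<close> is \<open>s\<close> times the gap between \<open>f\<close> and
    its infimum.\<close>
  let ?c = "\<lambda>k x. s * (inf_coord M k f x - m)"
  let ?T = "\<lambda>k x. exp (s * X x) * (s * X x - ?c k x - 1) + exp (?c k x)"
  have T: "bounded_measurable N (?T k)" if "k \<in> {1..n}" for k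
    by (intro bm_intros X_bm inf_bm that)
  have "s * W - F * ln F = (\<integral>x. (s * X x) * exp (s * X x) \<partial>N) - F * ln F"
    unfolding W_def by (simp add: mult.assoc)
  also have "\<dots> \<le> (\<Sum>k\<in>{1..n}. \<integral>x. ?T k x \<partial>N)"
    unfolding F_def N_def
  proof (rule entropy_subadditive[OF prob])
    show "bounded_measurable (PiM {1..n} M) (\<lambda>x. s * X x)"
      using X_bm unfolding N_def by (intro bm_intros)
    show "bounded_measurable (PiM {1..n} M) (?c k)" if "k \<in> {1..n}" for k
      using inf_bm[OF that] unfolding N_def by (intro bm_intros)
  qed simp_all
  also have "\<dots> = (\<integral>x. (\<Sum>k\<in>{1..n}. ?T k x) \<partial>N)"
    by (intro Bochner_Integration.integral_sum[symmetric] N_integrable T)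
  also have "\<dots> \<le> (\<integral>x. K * (a * (X x * exp (s * X x)) + V * exp (s * X x)) \<partial>N)"
  proof (rule integral_mono)
    show "integrable N (\<lambda>x. \<Sum>k\<in>{1..n}. ?T k x)"
      by (intro N_integrable bounded_measurable_sum T)
    show "integrable N (\<lambda>x. K * (a * (X x * exp (s * X x)) + V * exp (s * X x)))"
      by (intro N_integrable bm_intros X_bm)
    fix x assume x: "x \<in> space N"
    let ?u = "\<lambda>k. f x - inf_coord M k f x"
    \<comment> \<open>Pulling out \<open>exp (s * X x)\<close> leaves the function
      \<open>exp (- v) + v - 1\<close> at \<open>v = s * ?u k\<close>, to which the hypothesis on
      \<open>K\<close> applies.\<close>
    have "(\<Sum>k\<in>{1..n}. ?T k x) = exp (s * X x) * (\<Sum>k\<in>{1..n}. exp (- (s * ?u k)) + s * ?u k - 1)"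
      unfolding sum_distrib_left
    proof (rule sum.cong[OF refl])
      fix k
      have "s * X x - ?c k x = s * ?u k" by (simp add: X algebra_simps)
      moreover have "exp (?c k x) = exp (s * X x) * exp (- (s * ?u k))"
        by (simp add: X algebra_simps flip: exp_add)
      ultimately show "?T k x = exp (s * X x) * (exp (- (s * ?u k)) + s * ?u k - 1)"
        by (simp add: algebra_simps)
    qed
    also have "\<dots> \<le> exp (s * X x) * (\<Sum>k\<in>{1..n}. K * (?u k)\<^sup>2)"
      using f x inf_coord_le[of _ "{1..n}" M f x] unfolding N_def
      by (intro mult_left_mono sum_mono K) (auto simp: N_def)
    also have "\<dots> = exp (s * X x) * (K * variance_proxy n M f x)"
      by (simp add: variance_proxy_def sum_distrib_left)
    also have "\<dots> \<le> exp (s * X x) * (K * (a * X x + V))"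
      using Df[OF x] \<open>0 \<le> K\<close> by (intro mult_left_mono) auto
    finally show "(\<Sum>k\<in>{1..n}. ?T k x) \<le> K * (a * (X x * exp (s * X x)) + V * exp (s * X x))"
      by (simp add: algebra_simps)
  qed
  also have "\<dots> = K * (a * W + V * F)"
    unfolding W_def F_def
    by (simp add: N_integrable bm_intros X_bm)
  finally show ?thesis .
qed

text \<open>Both tails share the derivative of \<open>L\<close> and the inequality
  \<open>ineq\<close>; the additional assumptions enter only as premises of the second
  conclusion.\<close>

lemma self_bounding_tails:
  fixes M :: "nat \<Rightarrow> 'a measure" and n :: nat
  defines "N \<equiv> PiM {1..n} M"
  assumes prob: "\<And>k. prob_space (M k)"
    and f: "bounded_measurable N f"
    and inf: "\<And>k. k \<in> {1..n} \<Longrightarrow> inf_coord M k f \<in> borel_measurable N"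
    and "0 \<le> a"
    and Df: "\<And>x. x \<in> space N \<Longrightarrow> variance_proxy n M f x \<le> a * f x + b"
    and "0 < t"
  defines "m \<equiv> integral\<^sup>L N f"
  shows "measure N {x \<in> space N. t < f x - m} \<le> tail_bound t (a * m + b + a * t / 2)"
    and "1 \<le> a \<Longrightarrow> (\<And>k x. k \<in> {1..n} \<Longrightarrow> x \<in> space N \<Longrightarrow> f x - inf_coord M k f x \<le> 1) \<Longrightarrow>
      measure N {x \<in> space N. t < m - f x} \<le> tail_bound t (a * m + b)"
proof -
  interpret N: prob_space N unfolding N_def by (rule prob_space_PiM[OF prob])
  note N_integrable = integrable_bounded_measurable[OF N.prob_space_axioms]
  define X where "X = (\<lambda>x. f x - m)"
  define V where "V = a * m + b"
  define F where "F = (\<lambda>s. \<integral>x. exp (s * X x) \<partial>N)"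
  define W where "W = (\<lambda>s. \<integral>x. X x * exp (s * X x) \<partial>N)"
  define L where "L = (\<lambda>s. ln (F s))"
  define L' where "L' = (\<lambda>s. W s / F s)"
  have X_bm: "bounded_measurable N X" unfolding X_def by (intro bm_intros f)
  have X0: "(\<integral>x. X x \<partial>N) = 0"
    unfolding X_def m_def using N_integrable[OF f] by (simp add: N.prob_space)
  have af: "a * f x + b = a * X x + V" for x
    by (simp add: X_def V_def algebra_simps)
  \<comment> \<open>The variance proxy is a sum of squares, so integrating its upper bound shows
    \<open>V \<ge> 0\<close>.\<close>
  have "0 \<le> (\<integral>x. a * f x + b \<partial>N)"
  proof (rule Bochner_Integration.integral_nonneg)
    fix x assume "x \<in> space N"
    have "0 \<le> variance_proxy n M f x" by (simp add: variance_proxy_def sum_nonneg)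
    then show "0 \<le> a * f x + b" using Df[OF \<open>x \<in> space N\<close>] by linarith
  qed
  then have V: "0 \<le> V"
    unfolding V_def m_def using N_integrable[OF f] by (simp add: N.prob_space)
  have F_pos: "0 < F s" for s
    unfolding F_def by (intro integral_exp_pos N.prob_space_axioms bm_intros X_bm)
  have dL: "(L has_real_derivative L' s) (at s)" for s
    using mgf_has_derivative[OF N.prob_space_axioms X_bm, of s] F_pos[of s]
    unfolding L_def L'_def F_def W_def by (auto intro!: derivative_eq_intros)
  have L0: "L 0 = 0" "L' 0 = 0"
    using X0 by (simp_all add: L_def L'_def F_def W_def N.prob_space)
  have ineq: "s * L' s - L s \<le> K * (a * L' s + V)" if "0 \<le> K"
    and "\<And>k x u. k \<in> {1..n} \<Longrightarrow> x \<in> space N \<Longrightarrow> u = f x - inf_coord M k f x \<Longrightarrow> 0 \<le> u \<Longrightarrow>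
      exp (- (s * u)) + s * u - 1 \<le> K * u\<^sup>2" for s K
  proof -
    have "s * W s - F s * ln (F s) \<le> K * (a * W s + V * F s)"
      using prob f inf Df X_def that unfolding F_def W_def N_def af
      by (intro entropy_le_of_variance_proxy) auto
    then have "(s * W s - F s * ln (F s)) / F s \<le> K * (a * W s + V * F s) / F s"
      using F_pos[of s] by (intro divide_right_mono) auto
    then show ?thesis
      using F_pos[of s] by (simp add: L'_def L_def diff_divide_distrib add_divide_distrib distrib_left)
  qed

  \<comment> \<open>Enlarging \<open>V\<close> to \<open>V + \<epsilon>\<close> and letting \<open>\<epsilon> \<rightarrow> 0\<close> at the end also covers vanishing denominators.\<close>
  have up: "L s * (1 - a * s / 2) \<le> (V + \<epsilon>) * s\<^sup>2 / 2" if "0 < s" "0 < \<epsilon>" for s \<epsilon>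
  proof -
    have "L s * (1 - a * s / 2) \<le> V * s\<^sup>2 / 2"
    proof (rule upper_log_mgf_bound[OF dL L0 _ \<open>0 < s\<close>])
      fix r :: real assume "0 < r"
      then show "r * L' r - L r \<le> r\<^sup>2 / 2 * (a * L' r + V)"
        using exp_minus_le_quadratic[of "r * u" for u]
        by (intro ineq) (auto simp: power_mult_distrib)
    qed
    also have "\<dots> \<le> (V + \<epsilon>) * s\<^sup>2 / 2" using that by (simp add: mult_right_mono)
    finally show ?thesis .
  qed
  have "measure N {x \<in> space N. t < X x} \<le> tail_bound t (V + a * t / 2)"
  proof (rule le_tail_bound_of_eps[OF \<open>0 < t\<close>])
    show "0 \<le> V + a * t / 2" using V \<open>0 \<le> a\<close> \<open>0 < t\<close> by simp
    fix \<epsilon> :: real assume "0 < \<epsilon>"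
    \<comment> \<open>With \<open>s = t / D\<close> this gives
      \<open>D * (1 - a * s / 2) = V + \<epsilon>\<close>. The factor \<open>1 - a * s / 2\<close>
      is then positive, and cancelling \<open>V + \<epsilon>\<close> leaves the sub-Gaussian bound
      with constant \<open>D\<close>.\<close>
    define D where "D = V + a * t / 2 + \<epsilon>"
    have "0 < V + \<epsilon>" using V \<open>0 < \<epsilon>\<close> by simp
    moreover have "0 \<le> a * t / 2" using \<open>0 \<le> a\<close> \<open>0 < t\<close> by simp
    ultimately have "0 < D" unfolding D_def by linarith
    define s where "s = t / D"
    have "0 < s" using \<open>0 < D\<close> \<open>0 < t\<close> by (simp add: s_def)
    have "D * (1 - a * s / 2) = V + \<epsilon>"
      using \<open>0 < D\<close> by (simp add: s_def D_def field_simps)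
    then have e: "1 - a * s / 2 = (V + \<epsilon>) / D"
      using \<open>0 < D\<close> by (simp add: field_simps)
    have "(V + \<epsilon>) * (L s / D) \<le> (V + \<epsilon>) * (s\<^sup>2 / 2)"
      using up[OF \<open>0 < s\<close> \<open>0 < \<epsilon>\<close>] unfolding e by (simp add: mult_ac)
    then have "L s / D \<le> s\<^sup>2 / 2"
      using \<open>0 < V + \<epsilon>\<close> by (simp only: mult_le_cancel_left_pos)
    then have "L s \<le> D * s\<^sup>2 / 2"
      using \<open>0 < D\<close> by (simp add: pos_divide_le_eq mult_ac)
    then show "measure N {x \<in> space N. t < X x} \<le> exp (- t\<^sup>2 / (2 * (V + a * t / 2 + \<epsilon>)))"
      using chernoff_bound[OF N.prob_space_axioms X_bm \<open>0 < t\<close> \<open>0 < D\<close> s_def] by (simp add: L_def F_def D_def)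
  qed
  then show "measure N {x \<in> space N. t < f x - m} \<le> tail_bound t (a * m + b + a * t / 2)"
    by (simp add: X_def V_def)

  assume a: "1 \<le> a" and le1: "\<And>k x. k \<in> {1..n} \<Longrightarrow> x \<in> space N \<Longrightarrow> f x - inf_coord M k f x \<le> 1"
  have lo: "L (- s) \<le> V * s\<^sup>2 / 2" if "0 < s" for s
  proof (rule lower_log_mgf_bound[where Y = "\<lambda>s. L (- s)" and Y' = "\<lambda>s. - L' (- s)" and a = a])
    show "((\<lambda>s. L (- s)) has_real_derivative - L' (- r)) (at r)" for r
      using dL[of "- r"] by (simp flip: DERIV_mirror)
  next
    fix r :: real assume "0 < r"
    \<comment> \<open>\<open>X x\<close> and \<open>1 - exp (- r * X x)\<close> have the same sign,
      so reweighting by \<open>exp (- r * X x)\<close> can only lower the mean of \<open>X\<close>,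
      which is 0.\<close>
    have "W (- r) \<le> (\<integral>x. X x \<partial>N)"
      unfolding W_def
    proof (rule integral_mono)
      fix x
      have "0 \<le> X x * (1 - exp (- r * X x))"
        using \<open>0 < r\<close> by (cases "0 \<le> X x") (auto intro!: mult_nonneg_nonneg mult_nonpos_nonpos simp: mult_le_0_iff)
      then show "X x * exp (- r * X x) \<le> X x" by (simp add: algebra_simps)
    qed (intro N_integrable bm_intros X_bm)+
    then show "0 \<le> - L' (- r)"
      using F_pos[of "- r"] by (simp add: X0 L'_def divide_le_0_iff)
    have psi: "0 \<le> exp r - r - 1" using exp_ge_add_one_self[of r] by linarith
    \<comment> \<open>At the negative parameter \<open>- r\<close> the remainder
      \<open>exp (r * u) - r * u - 1\<close> is scaled by \<open>u^2\<close>, using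
      \<open>u \<le> 1\<close>.\<close>
    have "- r * L' (- r) - L (- r) \<le> (exp r - r - 1) * (a * L' (- r) + V)"
    proof (rule ineq[OF psi])
      fix k x u
      assume "k \<in> {1..n}" "x \<in> space N" "u = f x - inf_coord M k f x" "0 \<le> u"
      then show "exp (- (- r * u)) + - r * u - 1 \<le> (exp r - r - 1) * u\<^sup>2"
        using exp_remainder_scale[of r u] le1 \<open>0 < r\<close> by (simp add: mult.commute)
    qed
    then show "r * - L' (- r) - L (- r) \<le> (exp r - r - 1) * (V - a * - L' (- r))"
      by (simp add: algebra_simps)
  qed (use L0 a V that in simp_all)
  have "measure N {x \<in> space N. t < - X x} \<le> tail_bound t V"
  proof (rule le_tail_bound_of_eps[OF \<open>0 < t\<close> V])
    fix \<epsilon> :: real assume "0 < \<epsilon>"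
    have D: "0 < V + \<epsilon>" using V \<open>0 < \<epsilon>\<close> by simp
    define s where "s = t / (V + \<epsilon>)"
    have "0 < s" using D \<open>0 < t\<close> by (simp add: s_def)
    have nX: "bounded_measurable N (\<lambda>x. - X x)"
      using bounded_measurable_mult[OF bounded_measurable_const[of N "- 1"] X_bm] by simp
    have "L (- s) \<le> (V + \<epsilon>) * s\<^sup>2 / 2"
      using lo[OF \<open>0 < s\<close>] mult_right_mono[of V "V + \<epsilon>" "s\<^sup>2"] \<open>0 < \<epsilon>\<close> by simp
    then show "measure N {x \<in> space N. t < - X x} \<le> exp (- t\<^sup>2 / (2 * (V + \<epsilon>)))"
      using chernoff_bound[OF N.prob_space_axioms nX \<open>0 < t\<close> D s_def] by (simp add: L_def F_def)
  qed
  then show "measure N {x \<in> space N. t < m - f x} \<le> tail_bound t (a * m + b)"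
    by (simp add: X_def V_def)
qed

theorem theorem19:
  fixes n :: nat and M :: "nat \<Rightarrow> 'a measure"
    and f :: "(nat \<Rightarrow> 'a) \<Rightarrow> real" and a b :: real
  assumes "\<And>k. k \<in> {1..n} \<Longrightarrow> prob_space (M k)"
    and "f \<in> borel_measurable (PiM {1..n} M)"
    and "bounded (f ` space (PiM {1..n} M))"
    and "\<And>k. k \<in> {1..n} \<Longrightarrow> inf_coord M k f \<in> borel_measurable (PiM {1..n} M)"
    and "a \<ge> 0" and "b \<ge> 0"
    and "\<And>x. x \<in> space (PiM {1..n} M) \<Longrightarrow> variance_proxy n M f x \<le> a * f x + b"
  shows "(\<forall>t>0. \<P>(x in PiM {1..n} M. f x - integral\<^sup>L (PiM {1..n} M) f > t)
            \<le> tail_bound t (a * integral\<^sup>L (PiM {1..n} M) f + b + a * t / 2))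
       \<and> (a \<ge> 1 \<and> (\<forall>k\<in>{1..n}. \<forall>x\<in>space (PiM {1..n} M). f x - inf_coord M k f x \<le> 1) \<longrightarrow>
          (\<forall>t>0. \<P>(x in PiM {1..n} M. integral\<^sup>L (PiM {1..n} M) f - f x > t)
            \<le> tail_bound t (a * integral\<^sup>L (PiM {1..n} M) f + b)))"
proof -
  \<comment> \<open>Outside \<open>{1..n}\<close> the measures are arbitrary; trivial probability spaces do not change the product.\<close>
  define M' where "M' = (\<lambda>k. if k \<in> {1..n} then M k else count_space {undefined})"
  let ?N = "PiM {1..n} M"
  have prob: "prob_space (M' k)" for k
    using assms(1) by (auto simp: M'_def intro!: prob_spaceI)
  have N: "PiM {1..n} M' = ?N" by (intro PiM_cong) (auto simp: M'_def)
  have inf: "inf_coord M' k f = inf_coord M k f" if "k \<in> {1..n}" for k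
    using that by (simp add: fun_eq_iff inf_coord_def M'_def)
  have Df: "variance_proxy n M' f x = variance_proxy n M f x" for x
    unfolding variance_proxy_def using inf by (intro sum.cong) auto
  have f: "bounded_measurable ?N f"
    using assms(2,3) by (auto simp: bounded_measurable_def bounded_iff)
  have inf_meas: "inf_coord M' k f \<in> borel_measurable ?N" if "k \<in> {1..n}" for k
    using assms(4)[OF that] by (simp only: inf[OF that])
  note tails = self_bounding_tails[of M' n f a b, unfolded N Df, OF prob f inf_meas assms(5,7)]
  show ?thesis
  proof (intro conjI impI allI)
    fix t :: real assume "0 < t"
    then show "\<P>(x in ?N. f x - integral\<^sup>L ?N f > t) \<le> tail_bound t (a * integral\<^sup>L ?N f + b + a * t / 2)"
      by (intro tails(1)) simp_all
  next
    fix t :: real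
    assume "1 \<le> a \<and> (\<forall>k\<in>{1..n}. \<forall>x\<in>space ?N. f x - inf_coord M k f x \<le> 1)" and "0 < t"
    then show "\<P>(x in ?N. integral\<^sup>L ?N f - f x > t) \<le> tail_bound t (a * integral\<^sup>L ?N f + b)"
      by (intro tails(2)) (simp_all add: inf)
  qed
qed

end
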